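(* The Moore surface $M$ has no brush, i.e. every flow on $M$ has a fixed point.
   Context: The bordered Prüfer surface $P$: as a set, $P=H\sqcup\bigsqcup_{x\in\mathbb{R}}R_x$, where $H=\mathbb{R}\times\mathbb{R}_{>0}$ and $R_x=\{r_{x,s}: s\in\mathbb{R}\}$, $r_{x,s}$ being thought of as the ray issuing from $(x,0)$ into $H$ with slope $s=\Delta x/\Delta y$. For each $x\in\mathbb{R}$ let $\varphi_x\colon\mathbb{R}\times[0,\infty)\to H\cup R_x$ be the bijection $\varphi_x(s,y)=(x+sy,y)$ for $y>0$ and $\varphi_x(s,0)=r_{x,s}$. The topology of $P$ is the one for which every $\varphi_x$ is a homeomorphism onto an open subset $H\cup R_x$ of $P$. Then $P$ is a Hausdorff non-metrizable $2$-manifold with boundary, with boundary components $R_x\cong\mathbb{R}$. The Moore surface $M$ is the quotient of $P$ by the identifications $r_{x,s}\sim r_{x,-s}$ for all $x,s\in\mathbb{R}$; it is a Hausdorff non-metrizable $2$-manifold without boundary. A flow on $M$ is a continuous action $f\colon\mathbb{R}\times M\to M$ of the additive group $\mathbb{R}$; a brush is a flow without stationary points (points $p$ with $f(t,p)=p$ for all $t$). *)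

theory Defs
  imports "HOL-Analysis.Analysis"
begin

section \<open>The bordered Pruefer surface\<close>

text \<open>The points of \<open>H\<close> are the \<open>Inner a b\<close> with \<open>b > 0\<close>; \<open>Ray x s\<close> is the ray $r_{x,s}$.
  The type also contains the points \<open>Inner a b\<close> with \<open>b \<le> 0\<close>, which do not belong to the surface.\<close>

datatype prufer_point = Inner real real | Ray real real

definition open_half_plane :: "prufer_point set" where
  "open_half_plane = {Inner a b | a b. b > 0}"

definition rays_at :: "real \<Rightarrow> prufer_point set" where
  "rays_at x = range (Ray x)"

definition prufer_carrier :: "prufer_point set" where
  "prufer_carrier = open_half_plane \<union> (\<Union>x. rays_at x)"

abbreviation closed_half_plane :: "(real \<times> real) set" where
  "closed_half_plane \<equiv> UNIV \<times> {0..}"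

definition prufer_chart :: "real \<Rightarrow> real \<times> real \<Rightarrow> prufer_point" where
  "prufer_chart x = (\<lambda>(s, y). if y > 0 then Inner (x + s * y) y else Ray x s)"

text \<open>The topology is defined as the final one with respect to the charts. By
  \<open>prufer_topology_unique\<close> below, it is the only topology on \<open>P\<close> for which every chart is a
  homeomorphism onto an open subset.\<close>

definition prufer_open :: "prufer_point set \<Rightarrow> bool" where
  "prufer_open U \<longleftrightarrow> U \<subseteq> prufer_carrier \<and>
     (\<forall>x. openin (top_of_set closed_half_plane) {z \<in> closed_half_plane. prufer_chart x z \<in> U})"

definition prufer :: "prufer_point topology" where
  "prufer = topology prufer_open"

lemma prufer_chart_in: "z \<in> closed_half_plane \<Longrightarrow> prufer_chart x z \<in> open_half_plane \<union> rays_at x"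
  by (auto simp: prufer_chart_def open_half_plane_def rays_at_def)

lemma prufer_chart_in_carrier: "z \<in> closed_half_plane \<Longrightarrow> prufer_chart x z \<in> prufer_carrier"
  using prufer_chart_in[of z x] by (auto simp: prufer_carrier_def)

lemma istopology_prufer_open: "istopology prufer_open"
  unfolding istopology_def
proof (intro conjI allI impI)
  fix S T assume "prufer_open S" "prufer_open T"
  moreover have "{z \<in> closed_half_plane. prufer_chart x z \<in> S \<inter> T} =
      {z \<in> closed_half_plane. prufer_chart x z \<in> S} \<inter> {z \<in> closed_half_plane. prufer_chart x z \<in> T}" for x
    by auto
  ultimately show "prufer_open (S \<inter> T)"
    by (auto simp only: prufer_open_def intro: openin_Int)
next
  fix K assume K: "\<forall>S\<in>K. prufer_open S"
  have eq: "{z \<in> closed_half_plane. prufer_chart x z \<in> \<Union>K} =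
      \<Union>((\<lambda>S. {z \<in> closed_half_plane. prufer_chart x z \<in> S}) ` K)" for x
    by auto
  have "\<Union>K \<subseteq> prufer_carrier"
    using K unfolding prufer_open_def by blast
  moreover have "openin (top_of_set closed_half_plane) {z \<in> closed_half_plane. prufer_chart x z \<in> \<Union>K}" for x
    unfolding eq
  proof (rule openin_Union)
    fix W assume "W \<in> (\<lambda>S. {z \<in> closed_half_plane. prufer_chart x z \<in> S}) ` K"
    then obtain S where S: "S \<in> K" "W = {z \<in> closed_half_plane. prufer_chart x z \<in> S}"
      by (rule imageE)
    then have "prufer_open S" using K by (rule_tac bspec)
    then show "openin (top_of_set closed_half_plane) W"
      unfolding prufer_open_def S(2) by (rule conjunct2[THEN spec])
  qed
  ultimately show "prufer_open (\<Union>K)"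
    unfolding prufer_open_def by (intro conjI allI)
qed

lemma openin_prufer: "openin prufer U \<longleftrightarrow> prufer_open U"
  by (simp add: prufer_def istopology_prufer_open topology_inverse')

lemma topspace_prufer [simp]: "topspace prufer = prufer_carrier"
proof -
  have eq: "{z \<in> closed_half_plane. prufer_chart x z \<in> prufer_carrier} = closed_half_plane" for x
    using prufer_chart_in_carrier by blast
  have "prufer_open prufer_carrier"
    unfolding prufer_open_def eq by simp
  then show ?thesis
    using openin_subset[of prufer prufer_carrier] openin_topspace[of prufer]
    unfolding openin_prufer prufer_open_def[of "topspace prufer"] by blast
qed

lemma inj_on_prufer_chart: "inj_on (prufer_chart x) closed_half_plane"
  by (auto simp: inj_on_def prufer_chart_def split: if_splits)

lemma prufer_chart_image: "prufer_chart x ` closed_half_plane = open_half_plane \<union> rays_at x"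
proof
  show "prufer_chart x ` closed_half_plane \<subseteq> open_half_plane \<union> rays_at x"
    using prufer_chart_in by blast
  show "open_half_plane \<union> rays_at x \<subseteq> prufer_chart x ` closed_half_plane"
  proof
    fix p assume "p \<in> open_half_plane \<union> rays_at x"
    then consider a b where "p = Inner a b" "b > 0" | s where "p = Ray x s"
      by (auto simp: open_half_plane_def rays_at_def)
    then show "p \<in> prufer_chart x ` closed_half_plane"
    proof cases
      case 1
      then have "p = prufer_chart x ((a - x) / b, b)" "((a - x) / b, b) \<in> closed_half_plane"
        by (auto simp: prufer_chart_def)
      then show ?thesis by blast
    next
      case 2
      then have "p = prufer_chart x (s, 0)" "(s, 0) \<in> closed_half_plane"
        by (auto simp: prufer_chart_def)
      then show ?thesis by blast
    qed
  qed
qed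

lemma openin_prufer_chart_image:
  assumes "openin (top_of_set closed_half_plane) W"
  shows "openin prufer (prufer_chart x ` W)"
proof -
  have sub: "W \<subseteq> closed_half_plane"
    using assms openin_imp_subset by blast
  obtain V where V: "open V" "W = closed_half_plane \<inter> V"
    using assms by (auto simp: openin_open)
  have "openin (top_of_set closed_half_plane) {z \<in> closed_half_plane. prufer_chart x' z \<in> prufer_chart x ` W}" for x'
  proof (cases "x' = x")
    case True
    have "{z \<in> closed_half_plane. prufer_chart x z \<in> prufer_chart x ` W} = W"
      using sub inj_on_image_mem_iff[OF inj_on_prufer_chart[of x] _ sub] by blast
    then show ?thesis using assms True by simp
  next
    case False
    let ?O = "UNIV \<times> {0<..} :: (real \<times> real) set"
    let ?g = "\<lambda>z::real \<times> real. ((x' - x) / snd z + fst z, snd z)"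
    have eq: "{z \<in> closed_half_plane. prufer_chart x' z \<in> prufer_chart x ` W} = ?O \<inter> ?g -` V"
    proof (intro equalityI subsetI)
      fix z assume z: "z \<in> {z \<in> closed_half_plane. prufer_chart x' z \<in> prufer_chart x ` W}"
      obtain s y where sy: "z = (s, y)" by force
      obtain t u where tu: "(t, u) \<in> W" "prufer_chart x' (s, y) = prufer_chart x (t, u)"
        using z sy by auto
      have "y > 0" "u = y" "x' + s * y = x + t * y"
        using tu(2) False by (auto simp: prufer_chart_def split: if_splits)
      moreover from this have "t = (x' - x) / y + s"
        by (simp add: field_simps)
      ultimately show "z \<in> ?O \<inter> ?g -` V"
        using tu(1) V(2) sy by auto
    next
      fix z assume z: "z \<in> ?O \<inter> ?g -` V"
      then have "snd z > 0" "?g z \<in> closed_half_plane \<inter> V"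
        by (auto simp: mem_Times_iff)
      moreover from this have "prufer_chart x' z = prufer_chart x (?g z)"
        by (cases z) (simp add: prufer_chart_def field_simps)
      ultimately have "?g z \<in> W" "prufer_chart x' z = prufer_chart x (?g z)"
        using V(2) by simp_all
      then show "z \<in> {z \<in> closed_half_plane. prufer_chart x' z \<in> prufer_chart x ` W}"
        using z by auto
    qed
    have "open ?O"
      by (intro open_Times) auto
    moreover have "continuous_on ?O ?g"
      by (intro continuous_intros) auto
    ultimately have "open (?O \<inter> ?g -` V)"
      using V(1) continuous_open_preimage by blast
    moreover have "?O \<inter> ?g -` V \<subseteq> closed_half_plane" by auto
    ultimately show ?thesis
      unfolding eq by (simp add: openin_subset open_subset)
  qed
  moreover have "prufer_chart x ` W \<subseteq> prufer_carrier"
    using sub prufer_chart_in_carrier by blast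
  ultimately show ?thesis
    by (simp add: openin_prufer prufer_open_def)
qed

lemma openin_prufer_chart_range: "openin prufer (open_half_plane \<union> rays_at x)"
  using openin_prufer_chart_image[of closed_half_plane x] prufer_chart_image by auto

theorem homeomorphic_map_prufer_chart:
  "homeomorphic_map (top_of_set closed_half_plane)
     (subtopology prufer (open_half_plane \<union> rays_at x)) (prufer_chart x)"
proof (rule bijective_open_imp_homeomorphic_map)
  have ts: "topspace (subtopology prufer (open_half_plane \<union> rays_at x)) = open_half_plane \<union> rays_at x"
    by (metis openin_prufer_chart_range openin_subset topspace_subtopology_subset)
  have "continuous_map (top_of_set closed_half_plane) prufer (prufer_chart x)"
    using prufer_chart_in_carrier by (auto simp: continuous_map_def openin_prufer prufer_open_def)
  then show "continuous_map (top_of_set closed_half_plane)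
      (subtopology prufer (open_half_plane \<union> rays_at x)) (prufer_chart x)"
    using prufer_chart_in by (auto simp: continuous_map_in_subtopology)
  show "open_map (top_of_set closed_half_plane)
      (subtopology prufer (open_half_plane \<union> rays_at x)) (prufer_chart x)"
    unfolding open_map_def
  proof (intro allI impI)
    fix W assume W: "openin (top_of_set closed_half_plane) W"
    have "prufer_chart x ` W \<subseteq> open_half_plane \<union> rays_at x"
      using openin_imp_subset[OF W] prufer_chart_image by blast
    then show "openin (subtopology prufer (open_half_plane \<union> rays_at x)) (prufer_chart x ` W)"
      using openin_prufer_chart_image[OF W] openin_subtopology by blast
  qed
  show "prufer_chart x ` topspace (top_of_set closed_half_plane) =
      topspace (subtopology prufer (open_half_plane \<union> rays_at x))"
    using ts prufer_chart_image by simp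
  show "inj_on (prufer_chart x) (topspace (top_of_set closed_half_plane))"
    using inj_on_prufer_chart by simp
qed

theorem prufer_topology_unique:
  assumes ts: "topspace T = prufer_carrier"
    and op: "\<And>x. openin T (open_half_plane \<union> rays_at x)"
    and hom: "\<And>x. homeomorphic_map (top_of_set closed_half_plane)
        (subtopology T (open_half_plane \<union> rays_at x)) (prufer_chart x)"
  shows "T = prufer"
proof (rule topology_eq[THEN iffD2, rule_format])
  fix U
  show "openin T U \<longleftrightarrow> openin prufer U"
  proof
    assume U: "openin T U"
    have "continuous_map (top_of_set closed_half_plane) T (prufer_chart x)" for x
      using hom[of x] homeomorphic_imp_continuous_map continuous_map_into_fulltopology by blast
    then have "openin (top_of_set closed_half_plane) {z \<in> closed_half_plane. prufer_chart x z \<in> U}" for x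
      using U openin_continuous_map_preimage by fastforce
    moreover have "U \<subseteq> prufer_carrier"
      using U ts openin_subset by blast
    ultimately show "openin prufer U"
      by (simp add: openin_prufer prufer_open_def)
  next
    assume "openin prufer U"
    then have U: "U \<subseteq> prufer_carrier"
      "\<And>x. openin (top_of_set closed_half_plane) {z \<in> closed_half_plane. prufer_chart x z \<in> U}"
      by (auto simp: openin_prufer prufer_open_def)
    have "openin T (U \<inter> (open_half_plane \<union> rays_at x))" for x
    proof -
      have "prufer_chart x ` {z \<in> closed_half_plane. prufer_chart x z \<in> U} = U \<inter> (open_half_plane \<union> rays_at x)"
        unfolding prufer_chart_image[of x, symmetric] by blast
      then have "openin (subtopology T (open_half_plane \<union> rays_at x)) (U \<inter> (open_half_plane \<union> rays_at x))"
        using homeomorphic_imp_open_map[OF hom[of x], unfolded open_map_def, rule_format, OF U(2)[of x]]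
        by simp
      then show ?thesis
        using op[of x] by (simp add: openin_open_subtopology)
    qed
    then have "openin T (\<Union>x. U \<inter> (open_half_plane \<union> rays_at x))"
      by (intro openin_Union) auto
    moreover have "(\<Union>x. U \<inter> (open_half_plane \<union> rays_at x)) = U"
      using U(1) by (auto simp: prufer_carrier_def)
    ultimately show "openin T U" by simp
  qed
qed

section \<open>The Moore surface\<close>

definition moore_rel :: "(prufer_point \<times> prufer_point) set" where
  "moore_rel = Id_on prufer_carrier \<union> {(Ray x s, Ray x (- s)) | x s. True}"

lemma equiv_moore_rel: "equiv prufer_carrier moore_rel"
proof (rule equivI)
  have ray: "Ray x s \<in> prufer_carrier" for x s
    by (auto simp: prufer_carrier_def rays_at_def)
  show "moore_rel \<subseteq> prufer_carrier \<times> prufer_carrier" "refl_on prufer_carrier moore_rel"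
    by (auto simp: moore_rel_def refl_on_def ray)
  show "sym moore_rel"
    by (auto simp: moore_rel_def sym_def ray)
  show "trans moore_rel"
    by (auto simp: moore_rel_def trans_def ray)
qed

definition moore :: "prufer_point set topology" where
  "moore = topology (\<lambda>U. U \<subseteq> prufer_carrier // moore_rel \<and> openin prufer (\<Union>U))"

lemma openin_moore: "openin moore U \<longleftrightarrow> U \<subseteq> prufer_carrier // moore_rel \<and> openin prufer (\<Union>U)"
proof -
  have "istopology (\<lambda>U. U \<subseteq> prufer_carrier // moore_rel \<and> openin prufer (\<Union>U))"
    unfolding istopology_def
  proof (intro conjI allI impI)
    fix S T
    assume S: "S \<subseteq> prufer_carrier // moore_rel \<and> openin prufer (\<Union>S)"
      and T: "T \<subseteq> prufer_carrier // moore_rel \<and> openin prufer (\<Union>T)"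
    show "S \<inter> T \<subseteq> prufer_carrier // moore_rel"
      using S by blast
    have "\<Union>S \<inter> \<Union>T \<subseteq> \<Union>(S \<inter> T)"
    proof
      fix p assume "p \<in> \<Union>S \<inter> \<Union>T"
      then obtain C D where CD: "C \<in> S" "p \<in> C" "D \<in> T" "p \<in> D" by blast
      then have "C = D"
        using S T quotient_disj[OF equiv_moore_rel, of C D] by blast
      then show "p \<in> \<Union>(S \<inter> T)"
        using CD by blast
    qed
    then have "\<Union>(S \<inter> T) = \<Union>S \<inter> \<Union>T" by blast
    then show "openin prufer (\<Union>(S \<inter> T))"
      using S T openin_Int by metis
  next
    fix K :: "prufer_point set set set"
    assume K: "\<forall>S\<in>K. S \<subseteq> prufer_carrier // moore_rel \<and> openin prufer (\<Union>S)"
    show "\<Union>K \<subseteq> prufer_carrier // moore_rel"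
      using K by blast
    have "openin prufer (\<Union>(Union ` K))"
      using K by (intro openin_Union) blast
    moreover have "\<Union>(\<Union>K) = \<Union>(Union ` K)" by blast
    ultimately show "openin prufer (\<Union>(\<Union>K))" by simp
  qed
  then show ?thesis
    by (simp add: moore_def topology_inverse')
qed

lemma topspace_moore [simp]: "topspace moore = prufer_carrier // moore_rel"
proof -
  have "openin moore (prufer_carrier // moore_rel)"
    using Union_quotient[OF equiv_moore_rel] openin_topspace[of prufer] by (simp add: openin_moore)
  then show ?thesis
    using openin_subset[of moore] openin_topspace[of moore]
    unfolding openin_moore[of "topspace moore"] by blast
qed

theorem quotient_map_moore: "quotient_map prufer moore (\<lambda>p. moore_rel `` {p})"
  unfolding quotient_map_def
proof (intro conjI allI impI)
  show "(\<lambda>p. moore_rel `` {p}) ` topspace prufer = topspace moore"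
    by (auto simp: quotient_def)
  fix U assume "U \<subseteq> topspace moore"
  then have U: "U \<subseteq> prufer_carrier // moore_rel" by simp
  have "{p \<in> topspace prufer. moore_rel `` {p} \<in> U} = \<Union>U"
  proof (intro equalityI subsetI)
    fix p assume "p \<in> {p \<in> topspace prufer. moore_rel `` {p} \<in> U}"
    then show "p \<in> \<Union>U"
      using equiv_class_self[OF equiv_moore_rel, of p] by auto
  next
    fix p assume "p \<in> \<Union>U"
    then obtain C where C: "C \<in> U" "p \<in> C" by blast
    then obtain q where q: "q \<in> prufer_carrier" "C = moore_rel `` {q}"
      using U by (auto elim: quotientE)
    then have "moore_rel `` {p} = C" "p \<in> prufer_carrier"
      using C(2) equiv_class_eq[OF equiv_moore_rel, of q p] equiv_class_eq_iff[OF equiv_moore_rel, of q p] by auto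
    then show "p \<in> {p \<in> topspace prufer. moore_rel `` {p} \<in> U}"
      using C(1) by simp
  qed
  then show "openin prufer {p \<in> topspace prufer. moore_rel `` {p} \<in> U} = openin moore U"
    using U openin_moore by simp
qed

section \<open>Flows and brushes\<close>

definition flow_on :: "'a topology \<Rightarrow> (real \<Rightarrow> 'a \<Rightarrow> 'a) \<Rightarrow> bool" where
  "flow_on X f \<longleftrightarrow>
     continuous_map (prod_topology euclideanreal X) X (\<lambda>(t, p). f t p) \<and>
     (\<forall>p\<in>topspace X. f 0 p = p) \<and>
     (\<forall>s t. \<forall>p\<in>topspace X. f (s + t) p = f s (f t p))"

definition stationary_points :: "'a topology \<Rightarrow> (real \<Rightarrow> 'a \<Rightarrow> 'a) \<Rightarrow> 'a set" where
  "stationary_points X f = {p \<in> topspace X. \<forall>t. f t p = p}"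

definition brush_on :: "'a topology \<Rightarrow> (real \<Rightarrow> 'a \<Rightarrow> 'a) \<Rightarrow> bool" where
  "brush_on X f \<longleftrightarrow> flow_on X f \<and> stationary_points X f = {}"

end

theory Submission
  imports Defs
begin

text \<open>For fixed \<open>t\<close> and \<open>s\<close> the classes of the rays \<open>r\<^bsub>x,s\<^esub>\<close>, \<open>x\<close> real, form a discrete set, and
  so do their images under the homeomorphism \<open>f\<^sub>t\<close>. Since the open half-plane is second countable,
  only countably many of these images lie in it. By separability of the \<open>(t, s)\<close>-plane there is
  hence an \<open>x\<close> such that no ray at \<open>x\<close> ever enters the half-plane. By connectedness of the time
  line the half-line of rays at \<open>x\<close>, folded at \<open>r\<^bsub>x,0\<^esub>\<close>, is then invariant under the flow,
  and every homeomorphism of a closed half-line fixes its end point.\<close>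

section \<open>Homeomorphisms of a half-line\<close>

text \<open>If \<open>a = G 0\<close> were positive, the values \<open>0\<close> and
  \<open>a + 1\<close> would be taken at positive points \<open>b\<close> and \<open>d\<close>. By
  the intermediate value theorem \<open>a\<close> is then also taken at a positive point, against
  injectivity. Continuity is asked of \<open>G\<close> alone.\<close>

lemma half_line_bijection_fixes_0:
  fixes G K :: "real \<Rightarrow> real"
  assumes cont: "continuous_on {0..} G"
    and G: "\<And>s. 0 \<le> s \<Longrightarrow> 0 \<le> G s" and K: "\<And>s. 0 \<le> s \<Longrightarrow> 0 \<le> K s"
    and GK: "\<And>s. 0 \<le> s \<Longrightarrow> G (K s) = s" and KG: "\<And>s. 0 \<le> s \<Longrightarrow> K (G s) = s"
  shows "G 0 = 0"
proof (rule ccontr)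
  assume "G 0 \<noteq> 0"
  define a b d where "a = G 0" and "b = K 0" and "d = K (a + 1)"
  have a: "a > 0" using \<open>G 0 \<noteq> 0\<close> G[of 0] by (simp add: a_def)
  have b: "b > 0" "G b = 0" using GK[of 0] K[of 0] a by (auto simp: a_def b_def less_le)
  have d: "d > 0" "G d = a + 1" using GK[of "a + 1"] K[of "a + 1"] a by (auto simp: a_def d_def less_le)
  \<comment> \<open>The order of \<open>b\<close> and \<open>d\<close> is unknown, so both intervals
    are prepared.\<close>
  have "continuous_on {b..d} G" "continuous_on {d..b} G"
    using b d by (auto intro: continuous_on_subset[OF cont])
  then have "\<exists>c. min b d \<le> c \<and> G c = a"
    using IVT'[of G b a d] IVT2'[of G b a d] a b d by (cases "b \<le> d") (auto simp: min_def)
  then have "\<exists>c>0. G c = a"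
    using b d by (metis less_le_trans min_less_iff_conj)
  then obtain c where "c > 0" "G c = G 0" by (auto simp: a_def)
  with KG[of c] KG[of 0] show False by simp
qed

section \<open>Points and open sets of the Moore surface\<close>

abbreviation moore_class :: "prufer_point \<Rightarrow> prufer_point set" where
  "moore_class p \<equiv> moore_rel `` {p}"

definition moore_half_plane :: "prufer_point set set" where
  "moore_half_plane = moore_class ` open_half_plane"

definition moore_rays_at :: "real \<Rightarrow> prufer_point set set" where
  "moore_rays_at x = moore_class ` rays_at x"

lemma Ray_in_carrier [simp]: "Ray x s \<in> prufer_carrier"
  by (auto simp: prufer_carrier_def rays_at_def)

lemma Ray_notin_half_plane [simp]: "Ray x s \<notin> open_half_plane"
  by (auto simp: open_half_plane_def)

lemma Inner_in_half_plane [simp]: "Inner a b \<in> open_half_plane \<longleftrightarrow> b > 0"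
  by (auto simp: open_half_plane_def)

lemma moore_class_Ray: "moore_class (Ray x s) = {Ray x s, Ray x (- s)}"
  by (auto simp: moore_rel_def)

lemma moore_class_in_topspace: "p \<in> prufer_carrier \<Longrightarrow> moore_class p \<in> topspace moore"
  by (simp add: quotientI)

text \<open>Nonnegative slopes suffice as representatives: the classes at \<open>x\<close> are
  parametrised by a closed half-line.\<close>

lemma moore_class_Ray_abs: "moore_class (Ray x \<bar>s\<bar>) = moore_class (Ray x s)"
  by (auto simp: moore_class_Ray abs_if)

lemma moore_class_Ray_eq_iff:
  "moore_class (Ray x s) = moore_class (Ray x' s') \<longleftrightarrow> x = x' \<and> \<bar>s\<bar> = \<bar>s'\<bar>"
  by (auto simp: moore_class_Ray doubleton_eq_iff abs_if)

text \<open>The last assumption says that \<open>A\<close> is saturated for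
  \<open>moore_rel\<close>.\<close>

lemma moore_class_in_image_iff:
  assumes "p \<in> prufer_carrier" "A \<subseteq> prufer_carrier" "\<And>x s. Ray x s \<in> A \<Longrightarrow> Ray x (- s) \<in> A"
  shows "moore_class p \<in> moore_class ` A \<longleftrightarrow> p \<in> A"
proof
  assume "moore_class p \<in> moore_class ` A"
  then obtain q where q: "q \<in> A" "moore_class p = moore_class q" by auto
  then have "p \<in> moore_class q"
    using equiv_class_self[OF equiv_moore_rel assms(1)] by simp
  then show "p \<in> A"
    using q(1) assms(3) by (auto simp: moore_rel_def)
qed auto

lemma openin_moore_image:
  assumes "openin prufer A" "\<And>x s. Ray x s \<in> A \<Longrightarrow> Ray x (- s) \<in> A"
  shows "openin moore (moore_class ` A)"
proof -
  have A: "A \<subseteq> prufer_carrier" using openin_subset[OF assms(1)] by simp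
  then have "{p \<in> topspace prufer. moore_class p \<in> moore_class ` A} = A"
    using moore_class_in_image_iff[OF _ A assms(2)] by auto
  moreover have "moore_class ` A \<subseteq> topspace moore"
    using A moore_class_in_topspace by blast
  ultimately show ?thesis
    using quotient_map_moore assms(1) unfolding quotient_map_def by metis
qed

lemma continuous_map_prufer_chart:
  "continuous_map (top_of_set closed_half_plane) prufer (prufer_chart x)"
  using homeomorphic_imp_continuous_map[OF homeomorphic_map_prufer_chart]
    continuous_map_into_fulltopology by blast

lemma continuous_map_moore_chart:
  "continuous_map (top_of_set closed_half_plane) moore (\<lambda>z. moore_class (prufer_chart x z))"
  using continuous_map_compose[OF continuous_map_prufer_chart
      quotient_imp_continuous_map[OF quotient_map_moore]]
  by (simp add: o_def)

lemma continuous_map_moore_Ray: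
  "continuous_map euclideanreal moore (\<lambda>s. moore_class (Ray x s))"
proof -
  have "continuous_map euclideanreal (top_of_set closed_half_plane) (\<lambda>s. (s, 0))"
    by (auto simp: continuous_map_in_subtopology intro!: continuous_intros)
  from continuous_map_compose[OF this continuous_map_moore_chart[of x]]
  show ?thesis by (simp add: o_def prufer_chart_def)
qed

text \<open>Moves open sets of \<open>moore\<close> to the plane, where second countability is at
  hand.\<close>

lemma open_half_plane_preimage:
  assumes "openin moore V"
  shows "open {(a, b). b > 0 \<and> moore_class (Inner a b) \<in> V}"
proof -
  let ?O = "{z :: real \<times> real. snd z > 0}"
  have O: "open ?O" by (intro open_Collect_less continuous_intros)
  \<comment> \<open>On the interior this map inverts the chart at \<open>0\<close>, which sends
    \<open>(s, y)\<close> to \<open>Inner (s * y) y\<close>.\<close>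
  have "continuous_map (top_of_set ?O) (top_of_set closed_half_plane) (\<lambda>z. (fst z / snd z, snd z))"
    by (auto simp: continuous_map_in_subtopology intro!: continuous_intros)
  from continuous_map_compose[OF this continuous_map_moore_chart[of 0]]
  have "openin (top_of_set ?O)
      {z \<in> ?O. moore_class (prufer_chart 0 (fst z / snd z, snd z)) \<in> V}"
    using openin_continuous_map_preimage[OF _ assms] by (fastforce simp: o_def)
  also have "{z \<in> ?O. moore_class (prufer_chart 0 (fst z / snd z, snd z)) \<in> V} =
      {(a, b). b > 0 \<and> moore_class (Inner a b) \<in> V}"
    by (auto simp: prufer_chart_def)
  finally show ?thesis using O by (simp add: openin_open_eq)
qed

lemma openin_moore_half_plane: "openin moore moore_half_plane"
proof -
  have "openin prufer (prufer_chart 0 ` (UNIV \<times> {0<..}))"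
    by (intro openin_prufer_chart_image open_subset open_Times) auto
  also have "prufer_chart 0 ` (UNIV \<times> {0<..}) = open_half_plane"
  proof (intro equalityI subsetI)
    fix p assume "p \<in> open_half_plane"
    then obtain a b where "p = Inner a b" "b > 0" by (auto simp: open_half_plane_def)
    then have "p = prufer_chart 0 (a / b, b)" by (simp add: prufer_chart_def)
    with \<open>b > 0\<close> show "p \<in> prufer_chart 0 ` (UNIV \<times> {0<..})" by blast
  qed (auto simp: prufer_chart_def)
  finally show ?thesis
    unfolding moore_half_plane_def by (rule openin_moore_image) auto
qed

text \<open>These open sets contain no ray classes at base points other than \<open>x\<close>; they
  are the source of the discreteness used below.\<close>

lemma openin_moore_neighbourhood: "openin moore (moore_half_plane \<union> moore_rays_at x)"
  unfolding moore_half_plane_def moore_rays_at_def image_Un[symmetric]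
  by (rule openin_moore_image[OF openin_prufer_chart_range]) (auto simp: rays_at_def)

lemma moore_Ray_notin_half_plane: "moore_class (Ray x s) \<notin> moore_half_plane"
  unfolding moore_half_plane_def
  by (subst moore_class_in_image_iff) (auto simp: prufer_carrier_def rays_at_def)

lemma moore_Ray_in_rays_at_iff: "moore_class (Ray x s) \<in> moore_rays_at x' \<longleftrightarrow> x = x'"
  by (auto simp: moore_rays_at_def rays_at_def moore_class_Ray_eq_iff)

lemma topspace_moore_cases:
  assumes "C \<in> topspace moore"
  obtains a b where "b > 0" "C = moore_class (Inner a b)" | x s where "C = moore_class (Ray x s)"
  using assms by (auto simp: quotient_def prufer_carrier_def open_half_plane_def rays_at_def)

section \<open>Flows on the Moore surface\<close>

lemma flow_on_jointly_continuous:
  assumes "flow_on X f" "continuous_map Y euclideanreal u" "continuous_map Y X v"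
  shows "continuous_map Y X (\<lambda>y. f (u y) (v y))"
proof -
  have "continuous_map Y (prod_topology euclideanreal X) (\<lambda>y. (u y, v y))"
    using assms(2,3) by (simp add: continuous_map_pairwise o_def)
  moreover have "continuous_map (prod_topology euclideanreal X) X (\<lambda>(t, p). f t p)"
    using assms(1) by (simp add: flow_on_def)
  ultimately have "continuous_map Y X ((\<lambda>(t, p). f t p) \<circ> (\<lambda>y. (u y, v y)))"
    by (rule continuous_map_compose)
  then show ?thesis by (simp add: o_def)
qed

lemma flow_on_continuous_map:
  assumes "flow_on X f"
  shows "continuous_map X X (f t)"
  using flow_on_jointly_continuous[OF assms, of X "\<lambda>_. t" "\<lambda>p. p"] by simp

lemma flow_on_in_topspace: "flow_on X f \<Longrightarrow> p \<in> topspace X \<Longrightarrow> f t p \<in> topspace X"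
  using flow_on_continuous_map[of X f t] by (auto simp: continuous_map_def)

lemma flow_on_inverse:
  assumes "flow_on X f" "p \<in> topspace X"
  shows "f (- t) (f t p) = p"
proof -
  have "f (- t + t) p = f (- t) (f t p)" "f 0 p = p"
    using assms unfolding flow_on_def by blast+
  then show ?thesis by simp
qed

text \<open>A basic open set between \<open>z i\<close> and \<open>V i\<close> determines
  \<open>i\<close>, so \<open>I\<close> injects into a countable basis.\<close>

lemma countable_discrete_family:
  fixes z :: "'i \<Rightarrow> 'a :: second_countable_topology"
  assumes "\<And>i. i \<in> I \<Longrightarrow> open (V i)" "\<And>i. i \<in> I \<Longrightarrow> z i \<in> V i"
    and "\<And>i j. i \<in> I \<Longrightarrow> j \<in> I \<Longrightarrow> z j \<in> V i \<Longrightarrow> j = i"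
  shows "countable I"
proof -
  obtain B :: "'a set set" where B: "countable B" "topological_basis B"
    using ex_countable_basis by blast
  have "\<exists>U\<in>B. z i \<in> U \<and> U \<subseteq> V i" if "i \<in> I" for i
    by (rule topological_basisE[OF B(2) assms(1)[OF that] assms(2)[OF that]]) blast
  then have "\<forall>i\<in>I. \<exists>U. U \<in> B \<and> z i \<in> U \<and> U \<subseteq> V i" by blast
  from bchoice[OF this]
  obtain U where U: "\<And>i. i \<in> I \<Longrightarrow> U i \<in> B \<and> z i \<in> U i \<and> U i \<subseteq> V i" by blast
  have "inj_on U I"
  proof (rule inj_onI)
    fix i j assume ij: "i \<in> I" "j \<in> I" "U i = U j"
    then have "z j \<in> V i" using U by blast
    with ij assms(3) show "i = j" by blast
  qed
  moreover have "countable (U ` I)"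
    using U by (intro countable_subset[OF _ B(1)]) auto
  ultimately show ?thesis
    using countable_image_inj_on by blast
qed

lemma countable_Ray_entering_half_plane:
  assumes "flow_on moore f"
  shows "countable {x. f t (moore_class (Ray x s)) \<in> moore_half_plane}" (is "countable ?I")
proof -
  have "\<exists>a b. b > 0 \<and> f t (moore_class (Ray x s)) = moore_class (Inner a b)" if "x \<in> ?I" for x
    using that by (auto simp: moore_half_plane_def open_half_plane_def)
  then obtain a b where ab:
    "\<And>x. x \<in> ?I \<Longrightarrow> b x > 0 \<and> f t (moore_class (Ray x s)) = moore_class (Inner (a x) (b x))"
    by metis
  \<comment> \<open>\<open>V x\<close> is the image of the neighbourhood of the rays at
    \<open>x\<close> under the time \<open>t\<close> map, written as a preimage under its
    inverse.\<close>
  define V where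
    "V x = {p \<in> topspace moore. f (- t) p \<in> moore_half_plane \<union> moore_rays_at x}" for x
  have V: "openin moore (V x)" for x
    unfolding V_def
    by (rule openin_continuous_map_preimage[OF flow_on_continuous_map[OF assms] openin_moore_neighbourhood])
  have VI: "f t (moore_class (Ray x' s)) \<in> V x \<longleftrightarrow> x' = x" for x x'
    using flow_on_inverse[OF assms moore_class_in_topspace, of "Ray x' s" t]
      flow_on_in_topspace[OF assms moore_class_in_topspace, of "Ray x' s" t]
    by (simp add: V_def moore_Ray_notin_half_plane moore_Ray_in_rays_at_iff del: topspace_moore)
  show ?thesis
  proof (rule countable_discrete_family)
    show "open {(c, d). d > 0 \<and> moore_class (Inner c d) \<in> V x}" for x
      by (rule open_half_plane_preimage[OF V])
    show "(a x, b x) \<in> {(c, d). d > 0 \<and> moore_class (Inner c d) \<in> V x}" if "x \<in> ?I" for x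
      using ab[OF that] VI[of x x] by simp
    show "x' = x"
      if "x' \<in> ?I" "(a x', b x') \<in> {(c, d). d > 0 \<and> moore_class (Inner c d) \<in> V x}" for x x'
      using ab[OF that(1)] VI[of x' x] that(2) by simp
  qed
qed

text \<open>Each pair \<open>(t, s)\<close> of a countable dense set excludes only countably many
  \<open>x\<close>, so some \<open>x\<close> survives them all. The pairs for which the ray at this
  \<open>x\<close> enters the half-plane form an open set missing a dense one, hence an empty
  set.\<close>

lemma ex_Ray_avoiding_half_plane:
  assumes "flow_on moore f"
  shows "\<exists>x. \<forall>t s. f t (moore_class (Ray x s)) \<notin> moore_half_plane"
proof -
  obtain D :: "(real \<times> real) set" where D: "countable D"
    "\<And>X. open X \<Longrightarrow> X \<noteq> {} \<Longrightarrow> \<exists>d\<in>D. d \<in> X"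
    using countable_dense_exists by blast
  define N where "N = (\<Union>d\<in>D. {x. f (fst d) (moore_class (Ray x (snd d))) \<in> moore_half_plane})"
  have "countable N"
    unfolding N_def by (intro countable_UN D(1) countable_Ray_entering_half_plane[OF assms])
  then have "N \<noteq> UNIV"
    using uncountable_UNIV_real by auto
  then obtain x where "x \<notin> N" by auto
  then have x: "f (fst d) (moore_class (Ray x (snd d))) \<notin> moore_half_plane" if "d \<in> D" for d
    using that unfolding N_def by blast
  have "continuous_map (prod_topology euclideanreal euclideanreal) moore (\<lambda>z. moore_class (Ray x (snd z)))"
    using continuous_map_compose[OF continuous_map_snd continuous_map_moore_Ray] unfolding o_def .
  then have "continuous_map (prod_topology euclideanreal euclideanreal) moore
      (\<lambda>z. f (fst z) (moore_class (Ray x (snd z))))"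
    by (intro flow_on_jointly_continuous[OF assms] continuous_map_fst)
  from openin_continuous_map_preimage[OF this openin_moore_half_plane]
  have "open {z. f (fst z) (moore_class (Ray x (snd z))) \<in> moore_half_plane}" (is "open ?E")
    by simp
  with D(2)[of ?E] x have "?E = {}" by blast
  then have "f t (moore_class (Ray x s)) \<notin> moore_half_plane" for t s
    by (metis (mono_tags, lifting) empty_Collect_eq fst_conv snd_conv)
  then show ?thesis by blast
qed

lemma rays_at_invariant:
  assumes "flow_on moore f" "\<And>t. f t (moore_class (Ray x s)) \<notin> moore_half_plane"
  shows "f t (moore_class (Ray x s)) \<in> moore_rays_at x"
proof -
  let ?c = "\<lambda>t. f t (moore_class (Ray x s))"
  define S where "S x' = {t. ?c t \<in> moore_rays_at x'}" for x'
  have cont: "continuous_map euclideanreal moore ?c"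
    using moore_class_in_topspace[of "Ray x s"]
    by (intro flow_on_jointly_continuous[OF assms(1)]) (simp_all del: topspace_moore)
  \<comment> \<open>The orbit avoids the half-plane, so \<open>S x'\<close> is the full preimage of
    an open neighbourhood.\<close>
  have open_S: "open (S x')" for x'
    using openin_continuous_map_preimage[OF cont openin_moore_neighbourhood[of x']] assms(2)
    by (simp add: S_def)
  \<comment> \<open>The sets \<open>S x'\<close> partition the time line, so \<open>S x\<close> is
    also closed; it contains \<open>0\<close>, hence is everything by connectedness.\<close>
  have "- S x = (\<Union>x'\<in>-{x}. S x')"
  proof -
    have unique: "\<exists>!x'. t \<in> S x'" for t
    proof -
      have "?c t \<in> topspace moore"
        by (intro flow_on_in_topspace[OF assms(1)] moore_class_in_topspace Ray_in_carrier)
      then obtain x' u where "?c t = moore_class (Ray x' u)"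
      proof (cases rule: topspace_moore_cases)
        case (1 a b)
        then have "?c t \<in> moore_half_plane" by (simp add: moore_half_plane_def)
        with assms(2) show ?thesis by blast
      qed
      then show ?thesis by (simp add: S_def moore_Ray_in_rays_at_iff)
    qed
    show ?thesis
    proof (intro equalityI subsetI)
      fix t assume "t \<in> - S x"
      moreover from unique obtain x' where "t \<in> S x'" by blast
      ultimately show "t \<in> (\<Union>x'\<in>-{x}. S x')" by auto
    next
      fix t assume "t \<in> (\<Union>x'\<in>-{x}. S x')"
      then show "t \<in> - S x" using unique[of t] by auto
    qed
  qed
  then have "open (- S x)"
    by (simp only:) (intro open_UN ballI open_S)
  with open_S[of x] clopen[of "S x"] have "S x = {} \<or> S x = UNIV"
    by (simp only: closed_def simp_thms)
  moreover have "f 0 (moore_class (Ray x s)) = moore_class (Ray x s)"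
    using assms(1) moore_class_in_topspace[OF Ray_in_carrier, of x s] unfolding flow_on_def by (elim conjE bspec)
  then have "0 \<in> S x"
    by (simp only: S_def mem_Collect_eq moore_Ray_in_rays_at_iff)
  ultimately show ?thesis by (auto simp: S_def)
qed

lemma flow_on_moore_fixes_end_point:
  assumes flow: "flow_on moore f"
    and x: "\<And>t s. f t (moore_class (Ray x s)) \<in> moore_rays_at x"
  shows "f t (moore_class (Ray x 0)) = moore_class (Ray x 0)"
proof -
  have "\<exists>u\<ge>0. f t (moore_class (Ray x s)) = moore_class (Ray x u)" for t s
    using x[of t s] moore_class_Ray_abs[of x] abs_ge_zero
    unfolding moore_rays_at_def rays_at_def by (metis (no_types, lifting) imageE)
  \<comment> \<open>\<open>g t\<close> is the time \<open>t\<close> map read in the nonnegative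
    slope coordinate.\<close>
  then obtain g where g: "\<And>t s. 0 \<le> g t s"
    "\<And>t s. f t (moore_class (Ray x s)) = moore_class (Ray x (g t s))" by metis
  have inv: "g (- t) (g t s) = s" if "0 \<le> s" for t s
  proof -
    have "moore_class (Ray x (g (- t) (g t s))) = moore_class (Ray x s)"
      using flow_on_inverse[OF flow moore_class_in_topspace, of "Ray x s" t] by (simp add: g(2))
    then show ?thesis using that g(1)[of "- t"] by (simp add: moore_class_Ray_eq_iff)
  qed
  have "continuous_on UNIV (g t)" for t
    unfolding continuous_on_open_vimage[OF open_UNIV]
  proof (intro allI impI)
    fix W :: "real set" assume W: "open W"
    \<comment> \<open>The absolute value makes \<open>?W\<close> symmetric in the slope, so that
      \<open>?A\<close> is saturated and its image in \<open>moore\<close> is open.\<close>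
    let ?W = "{z \<in> closed_half_plane. \<bar>fst z\<bar> \<in> W}"
    let ?A = "prufer_chart x ` ?W"
    have "open ((\<lambda>z :: real \<times> real. \<bar>fst z\<bar>) -` W)"
      by (intro open_vimage W continuous_intros)
    then have "openin (top_of_set closed_half_plane) ?W"
      by (auto simp: openin_open)
    then have A: "openin prufer ?A" by (rule openin_prufer_chart_image)
    have Ray_A: "Ray x' s \<in> ?A \<longleftrightarrow> x' = x \<and> \<bar>s\<bar> \<in> W" for x' s
      by (force simp: prufer_chart_def split: if_splits)
    have sat: "Ray x' (- s) \<in> ?A" if "Ray x' s \<in> ?A" for x' s
      using that unfolding Ray_A by simp
    have "continuous_map euclideanreal moore (\<lambda>s. f t (moore_class (Ray x s)))"
      using continuous_map_compose[OF continuous_map_moore_Ray flow_on_continuous_map[OF flow]]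
      by (simp add: o_def)
    from openin_continuous_map_preimage[OF this openin_moore_image[OF A sat]]
    have "open {s. moore_class (Ray x (g t s)) \<in> moore_class ` ?A}"
      by (simp add: g(2))
    moreover have "moore_class (Ray x (g t s)) \<in> moore_class ` ?A \<longleftrightarrow> g t s \<in> W" for s
      using moore_class_in_image_iff[OF Ray_in_carrier _ sat, of x "g t s"] openin_subset[OF A] g(1)[of t s]
      unfolding Ray_A by simp
    ultimately show "open (g t -` W \<inter> UNIV)"
      by (simp add: vimage_def)
  qed
  then have "g t 0 = 0"
    \<comment> \<open>The two instances make \<open>g (- t)\<close> a two-sided inverse of
      \<open>g t\<close> on nonnegative slopes.\<close>
    using g(1) inv[of _ t] inv[of _ "- t"]
    by (intro half_line_bijection_fixes_0[of "g t" "g (- t)"])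
       (auto intro: continuous_on_subset)
  then show ?thesis by (simp add: g(2))
qed

theorem proposition3p8:
  shows "\<not> (\<exists>f. brush_on moore f) \<and>
    (\<forall>f. flow_on moore f \<longrightarrow> (\<exists>p\<in>topspace moore. \<forall>t. f t p = p))"
proof -
  have fixed: "\<exists>p\<in>topspace moore. \<forall>t. f t p = p" if f: "flow_on moore f" for f
  proof -
    obtain x where x: "\<And>t s. f t (moore_class (Ray x s)) \<notin> moore_half_plane"
      using ex_Ray_avoiding_half_plane[OF f] by blast
    show ?thesis
    \<comment> \<open>The witness is the folding point of the invariant half-line at
      \<open>x\<close>.\<close>
    proof (intro bexI allI)
      show "f t (moore_class (Ray x 0)) = moore_class (Ray x 0)" for t
        by (rule flow_on_moore_fixes_end_point[OF f rays_at_invariant[OF f x]])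
      show "moore_class (Ray x 0) \<in> topspace moore"
        by (rule moore_class_in_topspace[OF Ray_in_carrier])
    qed
  qed
  have "\<not> brush_on moore f" for f
  proof
    assume "brush_on moore f"
    then have "flow_on moore f" and empty: "stationary_points moore f = {}"
      by (simp_all only: brush_on_def)
    from fixed[OF this(1)] obtain p where "p \<in> topspace moore" "\<forall>t. f t p = p"
      by (rule bexE)
    then have "p \<in> stationary_points moore f"
      unfolding stationary_points_def by (intro CollectI conjI)
    with empty show False by simp
  qed
  then show ?thesis
    using fixed by (simp del: topspace_moore)
qed

end
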